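(* Let $X$ be a separable Banach space, let $N\ge 2$, let $T_1,\dots,T_N\in\mathcal{L}(X)$, and let $\mathcal{A}$ be one of the families $\mathcal{A}_\infty$, $\mathcal{A}_{uBd}$, $\mathcal{A}_{ud}$, $\mathcal{A}_{ld}$. Suppose there exist a dense set $Y_0$ in $X$, a dense sequence $(y_l)_{l\ge 1}\subset Y_0^N$ (with $y_l=(y_{l,1},\dots,y_{l,N})$), maps $S_n:Y_0^N\to X$ for $n\ge 0$, pairwise disjoint sets $A_k\in\mathcal{A}$, $k\ge 1$, and a sequence $(\varepsilon_k)_{k\ge 1}$ of positive real numbers tending to $0$ such that for each $l\ge 1$ and each $j\in[N]$: (1) $\sum_{n\in A_l}S_ny_l$ converges unconditionally in $X$, uniformly in $l$; (2) for any $n\in\bigcup_{k\ge 1}A_k$, $\Big\|\sum_{i\in A_l\setminus\{n\}}T_j^nS_iy_l\Big\|\le\varepsilon_l$; (3) for any $n\in A_l$ and any $k<l$, $\Big\|\sum_{i\in A_k}T_j^nS_iy_k\Big\|\le\varepsilon_l$; (4) for any $n\in A_l$, $\|T_j^nS_ny_l-y_{l,j}\|\le\varepsilon_l$. Then $T_1,\dots,T_N$ are disjoint $\mathcal{A}$-hypercyclic.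
   Context: $[N]=\{1,\dots,N\}$. $X$ is an infinite-dimensional Banach space over $\mathbb{K}=\mathbb{R}$ or $\mathbb{C}$, and $\mathcal{L}(X)$ is the algebra of continuous linear operators on $X$. For $A\subset\mathbb{N}$: $\underline{\mathrm{dens}}\,A=\liminf_{M\to\infty}\frac{\mathrm{card}\{n\le M:n\in A\}}{M}$, $\overline{\mathrm{dens}}\,A=\limsup_{M\to\infty}\frac{\mathrm{card}\{n\le M:n\in A\}}{M}$, $\overline{\mathrm{Bd}}\,A=\limsup_{M\to\infty}\max_{k\ge1}\frac{\mathrm{card}(A\cap\{k+1,\dots,k+M\})}{M}$. The families $\mathcal{A}_\infty,\mathcal{A}_{uBd},\mathcal{A}_{ud},\mathcal{A}_{ld}$ consist of the subsets of $\mathbb{N}$ that are, respectively, infinite, of positive upper Banach density, of positive upper density, of positive lower density. $T_1,\dots,T_N$ are disjoint $\mathcal{A}$-hypercyclic if there is $x\in X$ such that for all non-empty open $V_1,\dots,V_N\subset X$, $\{n: T_s^nx\in V_s\text{ for all }s\in[N]\}\in\mathcal{A}$ (i.e. $(x,\dots,x)$ is an $\mathcal{A}$-hypercyclic vector for $T_1\oplus\cdots\oplus T_N$ on $X^N$). Unconditional convergence of $\sum_{n\in A_l}S_ny_l$ uniformly in $l$ means: each series converges unconditionally, and for every $\varepsilon>0$ there is $M\ge1$ such that $\big\|\sum_{n\in F\cap A_l}S_ny_l\big\|\le\varepsilon$ for every $l\ge1$ and every finite set $F\subset[M,+\infty)\cap\mathbb{N}$. *)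

theory Defs
  imports "HOL-Analysis.Analysis"
begin

section \<open>Banach spaces over the reals or the complex numbers\<close>

text \<open>
  The library has no type class of Banach spaces over a general scalar field. Here
  the type class \<open>banach\<close> supplies the norm and completeness, and \<open>smul\<close> is the scalar
  multiplication. By the Gelfand-Mazur theorem a \<open>real_normed_field\<close> is, up to isometric
  isomorphism, either \<open>real\<close> or \<open>complex\<close>, so the scalar type \<open>'k\<close> covers exactly these two cases.
\<close>

locale banach_space_over = vector_space smul
  for smul :: "'k::real_normed_field \<Rightarrow> 'a::banach \<Rightarrow> 'a" +
  assumes norm_smul: "norm (smul c x) = norm c * norm x"
    and smul_of_real: "smul (of_real r) x = r *\<^sub>R x"

lemma banach_space_over_real: "banach_space_over ((*\<^sub>R) :: real \<Rightarrow> 'a::banach \<Rightarrow> 'a)"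
  by unfold_locales (auto simp: algebra_simps)

lemma banach_space_over_complex: "banach_space_over ((*) :: complex \<Rightarrow> complex \<Rightarrow> complex)"
  by unfold_locales (auto simp: algebra_simps norm_mult scaleR_conv_of_real)

definition infinite_dimensional :: "('k::field \<Rightarrow> 'a::ab_group_add \<Rightarrow> 'a) \<Rightarrow> bool" where
  "infinite_dimensional smul \<longleftrightarrow> \<not> (\<exists>B. finite B \<and> module.span smul B = UNIV)"

definition continuous_linear_operators ::
    "('k::real_normed_field \<Rightarrow> 'a::banach \<Rightarrow> 'a) \<Rightarrow> ('a \<Rightarrow> 'a) set" where
  "continuous_linear_operators smul =
     {T. Vector_Spaces.linear smul smul T \<and> continuous_on UNIV T}"

section \<open>Densities and families of sets of natural numbers\<close>

definition lower_density :: "nat set \<Rightarrow> ereal" where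
  "lower_density A = liminf (\<lambda>M. ereal (real (card {n. n \<le> M \<and> n \<in> A}) / real M))"

definition upper_density :: "nat set \<Rightarrow> ereal" where
  "upper_density A = limsup (\<lambda>M. ereal (real (card {n. n \<le> M \<and> n \<in> A}) / real M))"

definition upper_banach_density :: "nat set \<Rightarrow> ereal" where
  "upper_banach_density A =
     limsup (\<lambda>M. ereal (MAX k\<in>{1..}. real (card (A \<inter> {k+1..k+M})) / real M))"

text \<open>The maximum ranges over infinitely many \<open>k\<close> but only finitely many values occur, so \<open>Max\<close>
  is meaningful.\<close>

lemma finite_window_densities:
  "finite ((\<lambda>k. real (card (A \<inter> {k+1..k+M})) / real M) ` {1..})"
proof (rule finite_subset)
  have "card (A \<inter> {k+1..k+M}) \<le> M" for k
    using card_mono[of "{k+1..k+M}" "A \<inter> {k+1..k+M}"] by simp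
  then show "(\<lambda>k. real (card (A \<inter> {k+1..k+M})) / real M) ` {1..}
      \<subseteq> (\<lambda>c. real c / real M) ` {..M}"
    by blast
qed simp

definition family_infinite :: "nat set set" where
  "family_infinite = {A. infinite A}"

definition family_uBd :: "nat set set" where
  "family_uBd = {A. upper_banach_density A > 0}"

definition family_ud :: "nat set set" where
  "family_ud = {A. upper_density A > 0}"

definition family_ld :: "nat set set" where
  "family_ld = {A. lower_density A > 0}"

section \<open>Disjoint hypercyclicity\<close>

text \<open>The finite type \<open>'n\<close> plays the role of the index set \<open>{1, ..., N}\<close>, so that \<open>N = CARD('n)\<close>.\<close>

definition disjoint_hypercyclic ::
    "nat set set \<Rightarrow> ('n::finite \<Rightarrow> 'a::topological_space \<Rightarrow> 'a) \<Rightarrow> bool" where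
  "disjoint_hypercyclic \<A> T \<longleftrightarrow>
     (\<exists>x. \<forall>V. (\<forall>s. open (V s) \<and> V s \<noteq> {}) \<longrightarrow> {n. \<forall>s. (T s ^^ n) x \<in> V s} \<in> \<A>)"

section \<open>Uniform unconditional convergence\<close>

text \<open>The series \<open>\<Sum>n\<in>A l. f l n\<close> for \<open>l \<ge> 1\<close>; \<open>summable_on\<close> (convergence of the net of finite
  partial sums) is unconditional convergence.\<close>

definition unconditionally_convergent_uniformly ::
    "(nat \<Rightarrow> nat \<Rightarrow> 'a::real_normed_vector) \<Rightarrow> (nat \<Rightarrow> nat set) \<Rightarrow> bool" where
  "unconditionally_convergent_uniformly f A \<longleftrightarrow>
     (\<forall>l\<ge>1. f l summable_on A l) \<and>
     (\<forall>\<epsilon>>0. \<exists>M\<ge>1. \<forall>l\<ge>1. \<forall>F. finite F \<and> F \<subseteq> {M..} \<longrightarrow>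
        norm (\<Sum>n\<in>F \<inter> A l. f l n) \<le> \<epsilon>)"

end

theory Submission
  imports Defs
begin

text \<open>
  Write \<open>z l\<close> for the sum of \<open>S n (y l)\<close> over \<open>n \<in> A l\<close>. The vector \<open>z l\<close> is built so that
  its orbits under all the operators imitate \<open>y l\<close> simultaneously: at a time \<open>n \<in> A l\<close>, the term of
  index \<open>n\<close> is sent by \<open>T j ^^ n\<close> to almost \<open>y l $ j\<close>, and the other terms to something small.
  A disjoint hypercyclic vector is obtained by adding up a sparse sequence of these vectors,
  \<open>x = (\<Sum>m. z (L m))\<close> with \<open>L\<close> strictly increasing.

  At a time \<open>n \<in> A (L k)\<close>, the summands of index \<open>m > k\<close> contribute at most \<open>\<epsilon> (L m)\<close>, those
  of index \<open>m < k\<close> at most \<open>\<epsilon> (L k)\<close> each, and the summand of index \<open>k\<close> is within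
  \<open>2 * \<epsilon> (L k)\<close> of the target. If \<open>\<epsilon> (L m) \<le> (1/4)^m\<close>, each of these errors is at most
  \<open>2 * (1/2)^k * (1/2)^m\<close>, so together they are at most \<open>4 * (1/2)^k\<close>
  (\<open>sums_near_single_term\<close>), which tends to \<open>0\<close> with growing \<open>k\<close>.

  Two points remain. The series defining \<open>x\<close> must converge; this can be arranged because
  \<open>z l\<close> tends to \<open>0\<close>: the sets \<open>A l\<close> are pairwise disjoint, so they move off to infinity, where
  uniform convergence makes the sums small (\<open>uniformly_convergent_sums_tendsto_0\<close>). And the
  sparse sequence \<open>y (L m)\<close> must still be dense, which does not hold for subsequences in general.
  But nonempty open sets are infinite, as the space is nonzero, so a dense sequence visits each of them infinitely often
  (\<open>dense_sequence_frequently_in_open\<close>), and one can choose \<open>L m\<close> as large as desired with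
  \<open>y (L m)\<close> within \<open>1 / (m + 1)\<close> of \<open>y (m + 1)\<close>. Finally, the set of return times contains some
  \<open>A (L k)\<close>, and all four families are closed under passing to larger sets.
\<close>

section \<open>Families of sets of natural numbers are closed upwards\<close>

lemma lower_density_mono:
  assumes "A \<subseteq> B"
  shows "lower_density A \<le> lower_density B"
  unfolding lower_density_def
  using assms by (intro Liminf_mono always_eventually allI) (auto intro!: divide_right_mono card_mono)

lemma upper_density_mono:
  assumes "A \<subseteq> B"
  shows "upper_density A \<le> upper_density B"
  unfolding upper_density_def
  using assms by (intro Limsup_mono always_eventually allI) (auto intro!: divide_right_mono card_mono)

lemma upper_banach_density_mono:
  assumes "A \<subseteq> B"
  shows "upper_banach_density A \<le> upper_banach_density B"
  unfolding upper_banach_density_def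
proof (intro Limsup_mono always_eventually allI)
  fix M
  have "(MAX k\<in>{1..}. real (card (A \<inter> {k+1..k+M})) / real M)
      \<le> (MAX k\<in>{1..}. real (card (B \<inter> {k+1..k+M})) / real M)"
  proof (rule Max.boundedI[OF finite_window_densities])
    fix a assume "a \<in> (\<lambda>k. real (card (A \<inter> {k+1..k+M})) / real M) ` {1..}"
    then obtain k where k: "k \<ge> 1" "a = real (card (A \<inter> {k+1..k+M})) / real M" by auto
    have "a \<le> real (card (B \<inter> {k+1..k+M})) / real M"
      unfolding k(2) using assms by (intro divide_right_mono of_nat_mono card_mono) auto
    also have "\<dots> \<le> (MAX k\<in>{1..}. real (card (B \<inter> {k+1..k+M})) / real M)"
      using k(1) by (intro Max_ge[OF finite_window_densities]) auto
    finally show "a \<le> (MAX k\<in>{1..}. real (card (B \<inter> {k+1..k+M})) / real M)" .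
  qed auto
  then show "ereal (MAX k\<in>{1..}. real (card (A \<inter> {k+1..k+M})) / real M)
      \<le> ereal (MAX k\<in>{1..}. real (card (B \<inter> {k+1..k+M})) / real M)"
    by simp
qed

lemma density_families_upward_closed:
  assumes "\<A> \<in> {family_infinite, family_uBd, family_ud, family_ld}" "A \<in> \<A>" "A \<subseteq> B"
  shows "B \<in> \<A>"
  using assms upper_banach_density_mono[OF assms(3)] upper_density_mono[OF assms(3)]
    lower_density_mono[OF assms(3)]
  by (auto simp: family_infinite_def family_uBd_def family_ud_def family_ld_def
      dest: finite_subset)

section \<open>Dense sequences return to every open set\<close>

lemma infinite_dimensional_nonzero_vector:
  fixes smul :: "'k::field \<Rightarrow> 'a::ab_group_add \<Rightarrow> 'a"
  assumes "infinite_dimensional smul" "vector_space smul"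
  shows "\<exists>v::'a. v \<noteq> 0"
proof (rule ccontr)
  interpret vector_space smul by fact
  assume "\<nexists>v::'a. v \<noteq> 0"
  then have "span {} = UNIV" by (auto simp: span_empty)
  with assms(1) show False unfolding infinite_dimensional_def by blast
qed

text \<open>Balls are connected, and a finite connected set has at most one point, but every ball
  contains a small translate of its centre along \<open>v\<close>.\<close>

lemma open_infinite_if_nonzero_vector:
  fixes U :: "'a::real_normed_vector set"
  assumes "(v::'a) \<noteq> 0" "open U" "U \<noteq> {}"
  shows "infinite U"
proof
  assume "finite U"
  obtain x e where x: "e > 0" "ball x e \<subseteq> U"
    using assms(2,3) by (metis ex_in_conv open_contains_ball)
  have "finite (ball x e)"
    using \<open>finite U\<close> x(2) finite_subset by blast
  moreover have "x \<in> ball x e" "x + (e / (2 * norm v)) *\<^sub>R v \<in> ball x e"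
    "x + (e / (2 * norm v)) *\<^sub>R v \<noteq> x"
    using x(1) assms(1) by (auto simp: dist_norm)
  ultimately show False
    using connected_finite_iff_sing[OF connected_ball, of x e] by (metis empty_iff singletonD)
qed

text \<open>Only finitely many values are taken up to a given index; removing them from an open set
  leaves an open set that is still nonempty, so it contains a later value.\<close>

lemma dense_sequence_frequently_in_open:
  fixes y :: "nat \<Rightarrow> 'a::real_normed_vector"
  assumes "(v::'a) \<noteq> 0" "closure (y ` {1..}) = UNIV" "open U" "U \<noteq> {}"
  shows "\<exists>\<^sub>F l in sequentially. y l \<in> U"
  unfolding frequently_sequentially
proof
  fix n
  have "U - y ` {..n} \<noteq> {}"
    using open_infinite_if_nonzero_vector[OF assms(1,3,4)] by (metis finite_Diff2 finite.emptyI finite_atMost finite_imageI)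
  moreover have "open (U - y ` {..n})"
    using assms(3) by (intro open_Diff finite_imp_closed) auto
  ultimately have "(U - y ` {..n}) \<inter> y ` {1..} \<noteq> {}"
    using assms(2) open_Int_closure_eq_empty by (metis Int_UNIV_right)
  then obtain l where "y l \<in> U" "y l \<notin> y ` {..n}" by auto
  then show "\<exists>l\<ge>n. y l \<in> U"
    by (metis atMost_iff imageI nat_le_linear)
qed

lemma ex_strict_mono_frequently:
  fixes P :: "nat \<Rightarrow> nat \<Rightarrow> bool"
  assumes "\<And>m. \<exists>\<^sub>F l in sequentially. P m l"
  shows "\<exists>L. strict_mono L \<and> (\<forall>m. P m (L m))"
proof -
  have "\<exists>l>n. P m l" for m n
    using assms[of m] unfolding frequently_sequentially by (metis Suc_le_lessD)
  then have "\<exists>L. \<forall>m. P m (L m) \<and> L m < L (Suc m)"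
    by (intro dependent_nat_choice) metis+
  then show ?thesis
    by (auto simp: strict_mono_Suc_iff)
qed

section \<open>Series\<close>

text \<open>Each \<open>n < M\<close> lies in at most one of the sets \<open>A l\<close>, so for all large \<open>l\<close> the whole
  of \<open>A l\<close> lies in the range where uniform convergence bounds the partial sums.\<close>

lemma uniformly_convergent_sums_tendsto_0:
  fixes f :: "nat \<Rightarrow> nat \<Rightarrow> 'a::real_normed_vector"
  assumes f: "unconditionally_convergent_uniformly f A" and A: "disjoint_family_on A {1..}"
  shows "(\<lambda>l. infsum (f l) (A l)) \<longlonglongrightarrow> 0"
proof (rule tendstoI)
  fix r :: real assume "r > 0"
  then obtain M where M: "\<And>l F. l \<ge> 1 \<Longrightarrow> finite F \<Longrightarrow> F \<subseteq> {M..} \<Longrightarrow> norm (\<Sum>n\<in>F \<inter> A l. f l n) \<le> r / 2"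
    using f unfolding unconditionally_convergent_uniformly_def by (metis half_gt_zero)
  have avoid: "\<forall>\<^sub>F l in sequentially. n \<notin> A l" for n
  proof (cases "\<exists>k\<ge>1. n \<in> A k")
    case True
    then obtain k where "k \<ge> 1" "n \<in> A k" by blast
    then have "n \<notin> A l" if "l > k" for l
      using disjoint_family_onD[OF A, of k l] that by auto
    then show ?thesis
      using eventually_gt_at_top[of k] by (rule eventually_mono[rotated])
  next
    case False
    then show ?thesis
      by (auto simp: eventually_sequentially)
  qed
  have "\<forall>\<^sub>F l in sequentially. \<forall>n\<in>{..<M}. n \<notin> A l"
    using avoid by (intro eventually_ball_finite) auto
  then show "\<forall>\<^sub>F l in sequentially. dist (infsum (f l) (A l)) 0 < r"
    using eventually_ge_at_top[of 1]
  proof eventually_elim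
    case (elim l)
    have "(f l has_sum infsum (f l) (A l)) (A l)"
      using f elim(2) by (simp add: unconditionally_convergent_uniformly_def)
    then have lim: "(sum (f l) \<longlongrightarrow> infsum (f l) (A l)) (finite_subsets_at_top (A l))"
      by (simp add: has_sum_def)
    have "norm (sum (f l) F) \<le> r / 2" if "finite F" "F \<subseteq> A l" for F
    proof -
      have "F \<subseteq> {M..}" using elim(1) that(2) by (auto simp: not_less[symmetric])
      with M[OF elim(2) that(1)] that(2) show ?thesis by (simp add: Int_absorb2)
    qed
    then have "\<forall>\<^sub>F F in finite_subsets_at_top (A l). norm (sum (f l) F) \<le> r / 2"
      by (intro eventually_finite_subsets_at_top_weakI) auto
    from Lim_norm_ubound[OF _ lim this] show ?case
      using \<open>r > 0\<close> by simp
  qed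
qed

text \<open>Compare the series with the one whose only nonzero term is \<open>v\<close>, at index \<open>k\<close>: the
  differences of the terms are dominated by a geometric series.\<close>

lemma sums_near_single_term:
  fixes w :: "nat \<Rightarrow> 'a::banach"
  assumes "w sums s"
    and "\<And>m. m \<noteq> k \<Longrightarrow> norm (w m) \<le> 2 * (1/2)^k * (1/2)^m"
    and "norm (w k - v) \<le> 2 * (1/2)^k * (1/2)^k"
  shows "norm (s - v) \<le> 4 * (1/2)^k"
proof (rule norm_sums_le)
  show "(\<lambda>m. w m - (if m = k then v else 0)) sums (s - v)"
    using assms(1) sums_single[of k "\<lambda>_. v"] by (intro sums_diff) auto
  show "(\<lambda>m. 2 * (1/2)^k * (1/2)^m) sums (4 * (1/2)^k :: real)"
    using sums_mult[OF geometric_sums[of "1/2::real"], of "2 * (1/2)^k"] by simp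
  show "norm (w m - (if m = k then v else 0)) \<le> 2 * (1/2)^k * (1/2)^m" for m
    using assms(2,3) by auto
qed

section \<open>Additive continuous maps\<close>

text \<open>Additivity and continuity of the iterates are what allows them to be applied termwise, both
  to the unordered series over \<open>A l\<close> and to the series that defines the hypercyclic vector.\<close>

lemma continuous_linear_operator_power:
  assumes "banach_space_over smul" "T \<in> continuous_linear_operators smul"
  shows "Modules.additive (T ^^ n)" "isCont (T ^^ n) x"
proof -
  have lin: "Vector_Spaces.linear smul smul T" and cont: "continuous_on UNIV T"
    using assms(2) by (auto simp: continuous_linear_operators_def)
  interpret T: Vector_Spaces.linear smul smul T by (rule lin)
  show "Modules.additive (T ^^ n)"
    by (induction n) (auto simp: Modules.additive_def T.add)
  have "continuous_on UNIV (T ^^ n)"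
  proof (induction n)
    case (Suc n)
    then show ?case
      using continuous_on_compose[OF Suc continuous_on_subset[OF cont]] by simp
  qed simp
  then show "isCont (T ^^ n) x"
    by (simp add: continuous_on_eq_continuous_at)
qed

lemma additive_continuous_sums:
  fixes f :: "'a::real_normed_vector \<Rightarrow> 'b::real_normed_vector"
  assumes "Modules.additive f" "\<And>x. isCont f x" "w sums s"
  shows "(\<lambda>m. f (w m)) sums f s"
  using isCont_tendsto_compose[OF assms(2) assms(3)[unfolded sums_def]]
  by (simp add: sums_def Modules.additive.sum[OF assms(1)])

section \<open>The disjoint hypercyclicity criterion\<close>

theorem theorem2p1:
  fixes smul :: "'k::real_normed_field \<Rightarrow> 'a::banach \<Rightarrow> 'a"
    and T :: "'n::finite \<Rightarrow> 'a \<Rightarrow> 'a"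
    and \<A> :: "nat set set"
    and Y0 :: "'a set"
    and y :: "nat \<Rightarrow> 'a ^ 'n"
    and S :: "nat \<Rightarrow> 'a ^ 'n \<Rightarrow> 'a"
    and A :: "nat \<Rightarrow> nat set"
    and \<epsilon> :: "nat \<Rightarrow> real"
  assumes "banach_space_over smul"
    and "infinite_dimensional smul"
    and "separable_space (euclidean :: 'a topology)"
    and "CARD('n) \<ge> 2"
    and "\<And>j. T j \<in> continuous_linear_operators smul"
    and "\<A> \<in> {family_infinite, family_uBd, family_ud, family_ld}"
    and "closure Y0 = UNIV"
    and "\<And>l j. l \<ge> 1 \<Longrightarrow> y l $ j \<in> Y0"
    and "closure (y ` {1..}) = UNIV"
    and "\<And>k. k \<ge> 1 \<Longrightarrow> A k \<in> \<A>"
    and "disjoint_family_on A {1..}"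
    and "\<And>k. k \<ge> 1 \<Longrightarrow> \<epsilon> k > 0"
    and "\<epsilon> \<longlonglongrightarrow> 0"
    and "unconditionally_convergent_uniformly (\<lambda>l n. S n (y l)) A"
    and "\<And>l j n. l \<ge> 1 \<Longrightarrow> n \<in> (\<Union>k\<in>{1..}. A k) \<Longrightarrow>
           norm (\<Sum>\<^sub>\<infinity>i\<in>A l - {n}. (T j ^^ n) (S i (y l))) \<le> \<epsilon> l"
    and "\<And>l j n k. l \<ge> 1 \<Longrightarrow> n \<in> A l \<Longrightarrow> 1 \<le> k \<Longrightarrow> k < l \<Longrightarrow>
           norm (\<Sum>\<^sub>\<infinity>i\<in>A k. (T j ^^ n) (S i (y k))) \<le> \<epsilon> l"
    and "\<And>l j n. l \<ge> 1 \<Longrightarrow> n \<in> A l \<Longrightarrow>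
           norm ((T j ^^ n) (S n (y l)) - y l $ j) \<le> \<epsilon> l"
  shows "disjoint_hypercyclic \<A> T"
proof -
  define z where "z l = (\<Sum>\<^sub>\<infinity>i\<in>A l. S i (y l))" for l
  have z_sum: "(\<lambda>i. S i (y l)) summable_on A l" if "l \<ge> 1" for l
    using assms(14) that unfolding unconditionally_convergent_uniformly_def by blast
  have z_lim: "z \<longlonglongrightarrow> 0"
    using uniformly_convergent_sums_tendsto_0[OF assms(14,11)] unfolding z_def .
  have add: "Modules.additive (T j ^^ n)" and cont: "isCont (T j ^^ n) u" for j n u
    using continuous_linear_operator_power[OF assms(1) assms(5)] by auto
  have Tz_sum: "(\<lambda>i. (T j ^^ n) (S i (y l))) summable_on A l"
    and Tz: "(T j ^^ n) (z l) = (\<Sum>\<^sub>\<infinity>i\<in>A l. (T j ^^ n) (S i (y l)))" if "l \<ge> 1" for j n l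
  proof -
    have "((\<lambda>i. (T j ^^ n) (S i (y l))) has_sum (T j ^^ n) (z l)) (A l)"
      using has_sum_comm_additive[OF add[where j=j and n=n] isContD[OF cont]
          has_sum_infsum[OF z_sum[OF that]]]
      unfolding z_def o_def .
    then show "(\<lambda>i. (T j ^^ n) (S i (y l))) summable_on A l"
      "(T j ^^ n) (z l) = (\<Sum>\<^sub>\<infinity>i\<in>A l. (T j ^^ n) (S i (y l)))"
      by (auto simp: summable_on_def infsumI)
  qed
  have vs: "vector_space smul"
    using assms(1) by (simp add: banach_space_over_def)
  obtain v :: 'a where "v \<noteq> 0"
    using infinite_dimensional_nonzero_vector[OF assms(2) vs] by blast
  then have v: "(\<chi> i. v) \<noteq> (0 :: 'a ^ 'n)"
    by (simp add: vec_eq_iff)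

  (* The square in (1/2)^m * (1/2)^m is there because the larger of the indices m, k always
     supplies the bound on the m-th summand at a time in A (L k): its square is at most
     (1/2)^k * (1/2)^m, which is summable over m with a sum that is small for large k. *)
  define P where "P m l \<longleftrightarrow> y l \<in> ball (y (Suc m)) (1 / Suc m) \<and> l \<ge> 1
      \<and> \<epsilon> l \<le> (1/2)^m * (1/2)^m \<and> norm (z l) \<le> (1/2)^m" for m l
  have "\<exists>\<^sub>F l in sequentially. P m l" for m
  proof -
    have "\<forall>\<^sub>F l in sequentially. \<epsilon> l < (1/2)^m * (1/2)^m"
      using assms(13) by (rule order_tendstoD) simp
    moreover have "\<forall>\<^sub>F l in sequentially. norm (z l) < (1/2)^m"
      using tendsto_norm_zero[OF z_lim] by (rule order_tendstoD) simp
    ultimately have "\<forall>\<^sub>F l in sequentially. y l \<in> ball (y (Suc m)) (1 / Suc m) \<longrightarrow> P m l"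
      using eventually_ge_at_top[of 1]
      by eventually_elim (auto simp: P_def)
    moreover have "\<exists>\<^sub>F l in sequentially. y l \<in> ball (y (Suc m)) (1 / Suc m)"
      by (rule dense_sequence_frequently_in_open[OF v assms(9)]) auto
    ultimately show ?thesis
      by (rule frequently_mp)
  qed
  from ex_strict_mono_frequently[of P, OF this] obtain L where
    L: "strict_mono L" and PL: "\<And>m. P m (L m)" by blast
  have L1: "L m \<ge> 1" and Ly: "dist (y (Suc m)) (y (L m)) < 1 / Suc m"
    and L\<epsilon>: "\<epsilon> (L m) \<le> (1/2)^m * (1/2)^m" and Lz: "norm (z (L m)) \<le> (1/2)^m" for m
    using PL[of m] by (auto simp: P_def)

  define x where "x = (\<Sum>m. z (L m))"
  have "summable (\<lambda>m. z (L m))"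
    by (rule summable_comparison_test'[where g = "\<lambda>m. (1/2)^m" and N = 0]) (use Lz in auto)
  then have x: "(\<lambda>m. z (L m)) sums x"
    unfolding x_def by (rule summable_sums)

  have close: "norm ((T j ^^ n) x - y (L k) $ j) \<le> 4 * (1/2)^k" if n: "n \<in> A (L k)" for j n k
  proof (rule sums_near_single_term)
    show "(\<lambda>m. (T j ^^ n) (z (L m))) sums (T j ^^ n) x"
      by (rule additive_continuous_sums[OF add cont x])
    have other: "norm (\<Sum>\<^sub>\<infinity>i\<in>A (L m) - {n}. (T j ^^ n) (S i (y (L m)))) \<le> \<epsilon> (L m)" for m
      using n L1 by (intro assms(15)) auto
    show "norm ((T j ^^ n) (z (L m))) \<le> 2 * (1/2)^k * (1/2)^m" if "m \<noteq> k" for m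
    proof (cases "m < k")
      case True
      then have "L m < L k" using L by (simp add: strict_monoD)
      then have "norm ((T j ^^ n) (z (L m))) \<le> \<epsilon> (L k)"
        unfolding Tz[OF L1] by (intro assms(16) L1 n)
      also have "\<dots> \<le> (1/2)^k * (1/2)^k" by (rule L\<epsilon>)
      also have "\<dots> \<le> 2 * (1/2)^k * (1/2)^m"
        using True by (intro mult_mono power_decreasing) auto
      finally show ?thesis .
    next
      case False
      then have "k < m" using that by simp
      have "L m \<noteq> L k" using that L by (simp add: strict_mono_eq)
      then have "n \<notin> A (L m)"
        using n disjoint_family_onD[OF assms(11), of "L m" "L k"] L1[of m] L1[of k] by auto
      then have "norm ((T j ^^ n) (z (L m))) \<le> \<epsilon> (L m)"
        using other[of m] unfolding Tz[OF L1] by simp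
      also have "\<dots> \<le> (1/2)^m * (1/2)^m" by (rule L\<epsilon>)
      also have "\<dots> \<le> 2 * (1/2)^k * (1/2)^m"
      proof (rule mult_right_mono)
        have "(1/2)^m \<le> (1/2::real)^k" using \<open>k < m\<close> by (intro power_decreasing) auto
        also have "\<dots> \<le> 2 * (1/2)^k" by simp
        finally show "(1/2)^m \<le> 2 * (1/2::real)^k" .
      qed simp
      finally show ?thesis .
    qed
    have "(T j ^^ n) (z (L k)) = (\<Sum>\<^sub>\<infinity>i\<in>insert n (A (L k) - {n}). (T j ^^ n) (S i (y (L k))))"
      using n by (simp add: Tz[OF L1] insert_absorb)
    also have "\<dots> = (T j ^^ n) (S n (y (L k)))
        + (\<Sum>\<^sub>\<infinity>i\<in>A (L k) - {n}. (T j ^^ n) (S i (y (L k))))"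
      by (intro infsum_insert summable_on_cofin_subset Tz_sum L1) auto
    finally have "norm ((T j ^^ n) (z (L k)) - y (L k) $ j)
        \<le> norm ((T j ^^ n) (S n (y (L k))) - y (L k) $ j)
          + norm (\<Sum>\<^sub>\<infinity>i\<in>A (L k) - {n}. (T j ^^ n) (S i (y (L k))))"
      using norm_triangle_ineq[of "(T j ^^ n) (S n (y (L k))) - y (L k) $ j"]
      by (simp only: diff_add_eq)
    also have "\<dots> \<le> \<epsilon> (L k) + \<epsilon> (L k)"
      by (intro add_mono assms(17) L1 n other)
    finally show "norm ((T j ^^ n) (z (L k)) - y (L k) $ j) \<le> 2 * (1/2)^k * (1/2)^k"
      using L\<epsilon>[of k] by simp
  qed

  have "{n. \<forall>s. (T s ^^ n) x \<in> V s} \<in> \<A>" if V: "\<forall>s. open (V s) \<and> V s \<noteq> {}" for V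
  proof -
    have "\<exists>u r. r > 0 \<and> ball u r \<subseteq> V s" for s
      using V by (metis ex_in_conv open_contains_ball)
    then obtain u r where r: "\<And>s. r s > (0::real)" and ur: "\<And>s. ball (u s) (r s) \<subseteq> V s"
      by metis
    define \<rho> where "\<rho> = Min (range r)"
    have \<rho>: "\<rho> > 0" "\<And>s. \<rho> \<le> r s"
      using r by (auto simp: \<rho>_def)
    have "\<exists>\<^sub>F m in sequentially. y m \<in> ball (\<chi> s. u s) (\<rho>/3)"
      using \<rho>(1) by (intro dense_sequence_frequently_in_open[OF v assms(9)]) auto
    then have "\<exists>\<^sub>F m in sequentially. y (Suc m) \<in> ball (\<chi> s. u s) (\<rho>/3)"
      unfolding frequently_sequentially by (metis Suc_le_D Suc_le_mono)
    moreover have "\<forall>\<^sub>F m in sequentially. 1 / real (Suc m) < \<rho>/3"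
      using LIMSEQ_inverse_real_of_nat \<rho>(1)
      by (intro order_tendstoD) (auto simp: inverse_eq_divide)
    moreover have "\<forall>\<^sub>F m in sequentially. 4 * (1/2)^m < \<rho>/3"
    proof (rule order_tendstoD)
      show "(\<lambda>m. 4 * (1/2)^m) \<longlonglongrightarrow> (0::real)"
        by (intro tendsto_mult_right_zero LIMSEQ_power_zero) simp
    qed (use \<rho>(1) in simp)
    ultimately have "\<exists>\<^sub>F m in sequentially. (1 / real (Suc m) < \<rho>/3 \<and> 4 * (1/2)^m < \<rho>/3)
        \<and> y (Suc m) \<in> ball (\<chi> s. u s) (\<rho>/3)"
      by (intro frequently_eventually_conj[of "\<lambda>m. y (Suc m) \<in> ball (\<chi> s. u s) (\<rho>/3)"]
          eventually_conj)
    then obtain k where k: "dist (\<chi> s. u s) (y (Suc k)) < \<rho>/3"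
      "1 / real (Suc k) < \<rho>/3" "4 * (1/2)^k < \<rho>/3"
      using frequently_ex by fastforce
    have "(T s ^^ n) x \<in> V s" if "n \<in> A (L k)" for n s
    proof -
      have "dist (u s) (y (L k) $ s) \<le> dist (\<chi> s. u s) (y (L k))"
        using dist_vec_nth_le[of "\<chi> s. u s" s "y (L k)"] by simp
      also have "\<dots> < \<rho>/3 + \<rho>/3"
        using dist_triangle[of "\<chi> s. u s" "y (L k)" "y (Suc k)"] k(1,2) Ly[of k] by linarith
      finally have "dist (u s) (y (L k) $ s) < \<rho>/3 + \<rho>/3" .
      moreover have "dist (y (L k) $ s) ((T s ^^ n) x) < \<rho>/3"
        using close[OF that, of s] k(3) by (simp add: dist_norm norm_minus_commute)
      ultimately have "dist (u s) ((T s ^^ n) x) < r s"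
        using dist_triangle[of "u s" "(T s ^^ n) x" "y (L k) $ s"] \<rho>(2)[of s] by linarith
      then show ?thesis using ur[of s] by auto
    qed
    then have "A (L k) \<subseteq> {n. \<forall>s. (T s ^^ n) x \<in> V s}" by blast
    then show ?thesis
      by (rule density_families_upward_closed[OF assms(6) assms(10)[OF L1]])
  qed
  then show ?thesis
    unfolding disjoint_hypercyclic_def by blast
qed

end
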